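(* Let $G$ be a pro-$2$ group isomorphic to $C_2\times\mathbb{Z}_2$, where $C_2$ is the cyclic group of order $2$. Then no $2$-orientation $\theta\colon G\to\mathbb{Z}_2^\times$ (i.e. no continuous homomorphism) is $1$-cyclotomic.
   Context: For a profinite group $G$ and a continuous homomorphism $\theta\colon G\to\mathbb{Z}_2^\times$ (a $2$-orientation), $\mathbb{Z}_2(1)$ denotes the additive group $\mathbb{Z}_2$ with $G$-action $g\cdot z=\theta(g)z$. The orientation $\theta$ is $1$-cyclotomic if for every open subgroup $U\subseteq G$ and every $n\ge1$ the natural map $H^1(U,\mathbb{Z}_2(1)/2^n)\to H^1(U,\mathbb{Z}_2(1)/2)$ is surjective. *)

theory Defs
  imports
    "HOL-Analysis.Analysis"
    "HOL-Algebra.Elementary_Groups"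
    "HOL-Algebra.Ring"
begin

section \<open>Topological, profinite and pro-2 groups\<close>

locale topological_group = group G for G (structure) +
  fixes T :: "'a topology"
  assumes topspace_eq: "topspace T = carrier G"
    and continuous_mult: "continuous_map (prod_topology T T) T (\<lambda>(x, y). x \<otimes> y)"
    and continuous_inv: "continuous_map T T (\<lambda>x. inv x)"

definition profinite_group :: "('a, 'm) monoid_scheme \<Rightarrow> 'a topology \<Rightarrow> bool" where
  "profinite_group G T \<longleftrightarrow>
     topological_group G T \<and> compact_space T \<and> Hausdorff_space T \<and>
     (\<forall>x \<in> topspace T. connected_component_of_set T x = {x})"

definition pro_2_group :: "('a, 'm) monoid_scheme \<Rightarrow> 'a topology \<Rightarrow> bool" where
  "pro_2_group G T \<longleftrightarrow>
     profinite_group G T \<and>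
     (\<forall>N. N \<lhd> G \<and> openin T N \<longrightarrow> (\<exists>k::nat. card (rcosets\<^bsub>G\<^esub> N) = 2 ^ k))"

definition topological_group_isomorphic ::
    "('a, 'm) monoid_scheme \<Rightarrow> 'a topology \<Rightarrow> ('b, 'n) monoid_scheme \<Rightarrow> 'b topology \<Rightarrow> bool" where
  "topological_group_isomorphic G T H S \<longleftrightarrow> (\<exists>f. f \<in> iso G H \<and> homeomorphic_map T S f)"


section \<open>The 2-adic integers\<close>

text \<open>
  The 2-adic integers are the inverse limit of the rings \<open>\<int>/2\<^sup>n\<close>. The residue ring modulo \<open>2\<^sup>n\<close> is
  represented by \<open>{0..<2^n}\<close>, and the topology is the subspace topology of the product of the
  discrete residue rings.
\<close>

definition Z2 :: "(nat \<Rightarrow> int) ring" where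
  "Z2 = \<lparr>carrier = {x. \<forall>n. x n \<in> {0..<2 ^ n} \<and> x (Suc n) mod 2 ^ n = x n},
         mult = (\<lambda>x y n. (x n * y n) mod 2 ^ n),
         one = (\<lambda>n. 1 mod 2 ^ n),
         zero = (\<lambda>n. 0),
         add = (\<lambda>x y n. (x n + y n) mod 2 ^ n)\<rparr>"

definition Z2_topology :: "(nat \<Rightarrow> int) topology" where
  "Z2_topology =
     subtopology (product_topology (\<lambda>n. discrete_topology {0..<2 ^ n}) UNIV) (carrier Z2)"

lemma cring_Z2: "cring Z2"
proof (rule cringI)
  show "abelian_group Z2"
  proof (rule abelian_groupI)
    fix x y assume "x \<in> carrier Z2" "y \<in> carrier Z2"
    then have *: "x (Suc n) mod 2 ^ n = x n" "y (Suc n) mod 2 ^ n = y n" for n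
      by (auto simp: Z2_def)
    have "((x (Suc n) + y (Suc n)) mod 2 ^ Suc n) mod 2 ^ n = (x n + y n) mod 2 ^ n" for n
      using *[of n] by (metis mod_add_eq mod_mod_cancel le_imp_power_dvd lessI less_imp_le_nat)
    then show "x \<oplus>\<^bsub>Z2\<^esub> y \<in> carrier Z2" by (simp add: Z2_def)
  next
    fix x assume x: "x \<in> carrier Z2"
    then have *: "x (Suc n) mod 2 ^ n = x n" for n
      by (auto simp: Z2_def)
    have "((- x (Suc n)) mod 2 ^ Suc n) mod 2 ^ n = (- x n) mod 2 ^ n" for n
      using *[of n] by (metis mod_minus_eq mod_mod_cancel le_imp_power_dvd lessI less_imp_le_nat)
    then have "(\<lambda>n. (- x n) mod 2 ^ n) \<in> carrier Z2" by (simp add: Z2_def)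
    moreover have "(\<lambda>n. (- x n) mod 2 ^ n) \<oplus>\<^bsub>Z2\<^esub> x = \<zero>\<^bsub>Z2\<^esub>"
      by (simp add: Z2_def mod_simps)
    ultimately show "\<exists>y\<in>carrier Z2. y \<oplus>\<^bsub>Z2\<^esub> x = \<zero>\<^bsub>Z2\<^esub>" by blast
  qed (auto simp: Z2_def mod_simps algebra_simps)
  show "comm_monoid Z2"
  proof (rule comm_monoidI)
    fix x y assume "x \<in> carrier Z2" "y \<in> carrier Z2"
    then have *: "x (Suc n) mod 2 ^ n = x n" "y (Suc n) mod 2 ^ n = y n" for n
      by (auto simp: Z2_def)
    have "((x (Suc n) * y (Suc n)) mod 2 ^ Suc n) mod 2 ^ n = (x n * y n) mod 2 ^ n" for n
      using *[of n] by (metis mod_mult_eq mod_mod_cancel le_imp_power_dvd lessI less_imp_le_nat)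
    then show "x \<otimes>\<^bsub>Z2\<^esub> y \<in> carrier Z2" by (simp add: Z2_def)
  next
    have "((1::int) mod 2 ^ Suc n) mod 2 ^ n = 1 mod 2 ^ n" for n
      by (metis mod_mod_cancel le_imp_power_dvd lessI less_imp_le_nat)
    then show "\<one>\<^bsub>Z2\<^esub> \<in> carrier Z2" by (simp add: Z2_def)
  next
    fix x assume "x \<in> carrier Z2"
    then have "0 \<le> x n \<and> x n < 2 ^ n" for n
      by (simp add: Z2_def)
    then have "(1 mod 2 ^ n * x n) mod 2 ^ n = x n" for n
      by (metis mod_mult_left_eq mult_1 mod_pos_pos_trivial)
    then show "\<one>\<^bsub>Z2\<^esub> \<otimes>\<^bsub>Z2\<^esub> x = x" by (simp add: Z2_def)
  qed (auto simp: Z2_def mod_simps algebra_simps)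
  show "(x \<oplus>\<^bsub>Z2\<^esub> y) \<otimes>\<^bsub>Z2\<^esub> z = x \<otimes>\<^bsub>Z2\<^esub> z \<oplus>\<^bsub>Z2\<^esub> y \<otimes>\<^bsub>Z2\<^esub> z" for x y z
    by (simp add: Z2_def mod_simps algebra_simps)
qed


section \<open>First continuous cohomology with discrete coefficients\<close>

text \<open>
  \<open>M\<close> is an abelian group, written multiplicatively and given the discrete topology, on which
  \<open>G\<close> acts through \<open>act\<close>. Cochains are extensional, so that equality of cochains is equality of
  functions on \<open>carrier G\<close>.
\<close>

definition Z1 ::
    "('a, 'm) monoid_scheme \<Rightarrow> 'a topology \<Rightarrow> ('b, 'n) monoid_scheme \<Rightarrow> ('a \<Rightarrow> 'b \<Rightarrow> 'b)
      \<Rightarrow> ('a \<Rightarrow> 'b) monoid" where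
  "Z1 G T M act =
     \<lparr>carrier = {c \<in> carrier G \<rightarrow>\<^sub>E carrier M.
         continuous_map T (discrete_topology (carrier M)) c \<and>
         (\<forall>g \<in> carrier G. \<forall>h \<in> carrier G. c (g \<otimes>\<^bsub>G\<^esub> h) = c g \<otimes>\<^bsub>M\<^esub> act g (c h))},
      mult = (\<lambda>c d. \<lambda>g \<in> carrier G. c g \<otimes>\<^bsub>M\<^esub> d g),
      one = (\<lambda>g \<in> carrier G. \<one>\<^bsub>M\<^esub>)\<rparr>"

definition B1 ::
    "('a, 'm) monoid_scheme \<Rightarrow> ('b, 'n) monoid_scheme \<Rightarrow> ('a \<Rightarrow> 'b \<Rightarrow> 'b) \<Rightarrow> ('a \<Rightarrow> 'b) set" where
  "B1 G M act = (\<lambda>m. \<lambda>g \<in> carrier G. act g m \<otimes>\<^bsub>M\<^esub> inv\<^bsub>M\<^esub> m) ` carrier M"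

definition H1 ::
    "('a, 'm) monoid_scheme \<Rightarrow> 'a topology \<Rightarrow> ('b, 'n) monoid_scheme \<Rightarrow> ('a \<Rightarrow> 'b \<Rightarrow> 'b)
      \<Rightarrow> ('a \<Rightarrow> 'b) set monoid" where
  "H1 G T M act = Z1 G T M act Mod B1 G M act"

text \<open>
  The map induced on first cohomology by an equivariant homomorphism \<open>f\<close> into \<open>N\<close>: the image of
  the class of a cocycle \<open>c\<close> under \<open>f\<close> is contained in the class of \<open>f \<circ> c\<close>, and multiplying by
  the coboundaries of \<open>N\<close> gives the whole class.
\<close>

definition H1_map ::
    "('a, 'm) monoid_scheme \<Rightarrow> 'a topology \<Rightarrow> ('c, 'n) monoid_scheme \<Rightarrow> ('a \<Rightarrow> 'c \<Rightarrow> 'c)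
      \<Rightarrow> ('b \<Rightarrow> 'c) \<Rightarrow> ('a \<Rightarrow> 'b) set \<Rightarrow> ('a \<Rightarrow> 'c) set" where
  "H1_map G T N act f C =
     B1 G N act <#>\<^bsub>Z1 G T N act\<^esub> (\<lambda>c. compose (carrier G) f c) ` C"


section \<open>1-cyclotomic 2-orientations\<close>

definition two_orientation ::
    "('a, 'm) monoid_scheme \<Rightarrow> 'a topology \<Rightarrow> ('a \<Rightarrow> nat \<Rightarrow> int) \<Rightarrow> bool" where
  "two_orientation G T \<theta> \<longleftrightarrow>
     \<theta> \<in> hom G (units_of Z2) \<and> continuous_map T (subtopology Z2_topology (Units Z2)) \<theta>"

definition two_pow_Z2 :: "nat \<Rightarrow> (nat \<Rightarrow> int) set" where
  "two_pow_Z2 n = (\<lambda>z. [((2::nat) ^ n)] \<cdot>\<^bsub>Z2\<^esub> z) ` carrier Z2"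

definition Z2_mod_two_pow :: "nat \<Rightarrow> (nat \<Rightarrow> int) set monoid" where
  "Z2_mod_two_pow n = add_monoid Z2 Mod two_pow_Z2 n"

definition twist_action :: "('a \<Rightarrow> nat \<Rightarrow> int) \<Rightarrow> 'a \<Rightarrow> (nat \<Rightarrow> int) \<Rightarrow> (nat \<Rightarrow> int)" where
  "twist_action \<theta> g z = \<theta> g \<otimes>\<^bsub>Z2\<^esub> z"

text \<open>The induced action on cosets; it does not depend on the modulus.\<close>

definition twist_quotient_action ::
    "('a \<Rightarrow> nat \<Rightarrow> int) \<Rightarrow> 'a \<Rightarrow> (nat \<Rightarrow> int) set \<Rightarrow> (nat \<Rightarrow> int) set" where
  "twist_quotient_action \<theta> g C = twist_action \<theta> g ` C"

text \<open>For \<open>n \<ge> 1\<close>, this sends the coset of \<open>z\<close> modulo \<open>2\<^sup>n\<close> to the coset of \<open>z\<close> modulo \<open>2\<close>.\<close>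

definition reduce_mod_two :: "(nat \<Rightarrow> int) set \<Rightarrow> (nat \<Rightarrow> int) set" where
  "reduce_mod_two C = two_pow_Z2 1 <#>\<^bsub>add_monoid Z2\<^esub> C"

definition one_cyclotomic ::
    "('a, 'm) monoid_scheme \<Rightarrow> 'a topology \<Rightarrow> ('a \<Rightarrow> nat \<Rightarrow> int) \<Rightarrow> bool" where
  "one_cyclotomic G T \<theta> \<longleftrightarrow>
     (\<forall>U n. subgroup U G \<and> openin T U \<and> n \<ge> 1 \<longrightarrow>
        H1_map (G\<lparr>carrier := U\<rparr>) (subtopology T U)
            (Z2_mod_two_pow 1) (twist_quotient_action \<theta>) reduce_mod_two
          ` carrier (H1 (G\<lparr>carrier := U\<rparr>) (subtopology T U)
              (Z2_mod_two_pow n) (twist_quotient_action \<theta>))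
        = carrier (H1 (G\<lparr>carrier := U\<rparr>) (subtopology T U)
              (Z2_mod_two_pow 1) (twist_quotient_action \<theta>)))"

end

theory Submission
  imports Defs
begin

text \<open>
  The surjectivity already fails for \<open>U = G\<close> and \<open>n = 2\<close>. Let \<open>x\<close> and \<open>y\<close> be commuting topological
  generators of \<open>G\<close> with \<open>x\<^sup>2 = 1\<close>, and let \<open>\<gamma>\<close> be a cocycle modulo 4 lifting a homomorphism
  \<open>G \<rightarrow> \<int>/2\<close>; coboundaries are even because \<open>\<theta>\<close> takes odd values. If \<open>\<theta>(x) \<equiv> 1\<close> modulo 4, then
  \<open>0 = \<gamma>(x\<^sup>2) = 2\<gamma>(x)\<close>, so a homomorphism that is nontrivial on \<open>x\<close> does not lift. If \<open>\<theta>(x) \<equiv> -1\<close>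
  modulo 4, then \<open>\<gamma>(xy) = \<gamma>(yx)\<close> gives \<open>(1 - \<theta>(y))\<gamma>(x) = 2\<gamma>(y)\<close>, so a homomorphism that is trivial
  on \<open>x\<close> and nontrivial on \<open>y\<close> does not lift.
\<close>

(* The filler field of add_monoid is undefined :: unit, which this simproc would rewrite to (). *)
declare [[simproc del: unit_eq]]

section \<open>Coordinates of 2-adic integers and residues of cosets\<close>

text \<open>Replaces computation with cosets by integer arithmetic modulo \<open>2^n\<close>. It is
  asked of any nonempty set, not only of full cosets, so that images and products of sets can be
  handled before they are known to be cosets; nonemptiness makes \<open>r\<close> unique.\<close>

definition residue :: "nat \<Rightarrow> (nat \<Rightarrow> int) set \<Rightarrow> int \<Rightarrow> bool" where
  "residue n C r \<longleftrightarrow> C \<subseteq> carrier Z2 \<and> C \<noteq> {} \<and> (\<forall>z\<in>C. z n = r)"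

lemma residue_unique: "residue n C r \<Longrightarrow> residue n C s \<Longrightarrow> r = s"
  by (auto simp: residue_def)

lemma Z2_range: "z \<in> carrier Z2 \<Longrightarrow> 0 \<le> z n \<and> z n < 2 ^ n"
  by (simp add: Z2_def)

lemma Z2_mod_le:
  assumes "z \<in> carrier Z2" "m \<le> n"
  shows "z n mod 2 ^ m = z m"
  using assms(2)
proof (induction n rule: dec_induct)
  case base
  then show ?case using Z2_range[OF assms(1)] by simp
next
  case (step n)
  have "z (Suc n) mod 2 ^ m = z (Suc n) mod 2 ^ n mod 2 ^ m"
    using step.hyps by (metis mod_mod_cancel le_imp_power_dvd)
  then show ?case using step assms(1) by (simp add: Z2_def)
qed

lemma Z2_add_apply: "(x \<oplus>\<^bsub>Z2\<^esub> y) n = (x n + y n) mod 2 ^ n"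
  by (simp add: Z2_def)

lemma Z2_mult_apply: "(x \<otimes>\<^bsub>Z2\<^esub> y) n = (x n * y n) mod 2 ^ n"
  by (simp add: Z2_def)

interpretation Z2: cring Z2
  by (rule cring_Z2)

lemma Z2_nat_mult_apply:
  "z \<in> carrier Z2 \<Longrightarrow> ([(k::nat)] \<cdot>\<^bsub>Z2\<^esub> z) n = (int k * z n) mod 2 ^ n"
proof (induction k)
  case 0
  have "\<zero>\<^bsub>Z2\<^esub> n = 0" by (simp add: Z2_def)
  then show ?case by simp
next
  case (Suc k)
  then show ?case
    by (simp add: Z2_add_apply mod_simps algebra_simps)
qed

text \<open>Makes divisibility by \<open>2^n\<close> a condition on a single coordinate. The
  inclusion that needs work is the division by \<open>2^n\<close>.\<close>

lemma two_pow_Z2_eq: "two_pow_Z2 n = {z \<in> carrier Z2. z n = 0}"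
proof (intro equalityI subsetI)
  fix w assume "w \<in> two_pow_Z2 n"
  then show "w \<in> {z \<in> carrier Z2. z n = 0}"
    by (auto simp: two_pow_Z2_def Z2_nat_mult_apply)
next
  fix w assume "w \<in> {z \<in> carrier Z2. z n = 0}"
  then have w: "w \<in> carrier Z2" "w n = 0" by auto
  \<comment> \<open>Division by \<open>2^n\<close> loses \<open>n\<close> binary digits, so
    coordinate \<open>m\<close> of the quotient is read off from coordinate \<open>m + n\<close> of
    \<open>w\<close>.\<close>
  define z where "z = (\<lambda>m. w (m + n) div 2 ^ n)"
  have w_eq: "w (m + n) = 2 ^ n * z m" for m
    using Z2_mod_le[OF w(1), of n "m + n"] w(2) by (simp add: z_def mod_0_imp_dvd)
  have "0 \<le> z m \<and> z m < 2 ^ m" for m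
    using Z2_range[OF w(1), of "m + n"] by (simp add: w_eq power_add zero_le_mult_iff mult.commute)
  moreover have "z (Suc m) mod 2 ^ m = z m" for m
    using Z2_mod_le[OF w(1), of "m + n" "Suc m + n"]
    unfolding w_eq by (simp add: power_add mult.commute flip: mult_mod_right)
  ultimately have z: "z \<in> carrier Z2" by (simp add: Z2_def)
  have "([((2::nat) ^ n)] \<cdot>\<^bsub>Z2\<^esub> z) m = w m" for m
    using Z2_mod_le[OF w(1), of m "m + n"] by (simp add: Z2_nat_mult_apply[OF z] flip: w_eq)
  then show "w \<in> two_pow_Z2 n"
    unfolding two_pow_Z2_def using z by (metis (no_types, lifting) ext image_eqI)
qed

lemma two_pow_Z2_normal: "two_pow_Z2 n \<lhd> add_monoid Z2"
proof -
  have "subgroup (two_pow_Z2 n) (add_monoid Z2)"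
  proof (rule group.subgroupI[OF Z2.add.is_group])
    show "two_pow_Z2 n \<noteq> {}" unfolding two_pow_Z2_def by auto
    fix a assume "a \<in> two_pow_Z2 n"
    then have a: "a \<in> carrier Z2" "a n = 0" by (auto simp: two_pow_Z2_eq)
    then have neg: "\<ominus>\<^bsub>Z2\<^esub> a \<in> carrier Z2" by simp
    have "(a n + (\<ominus>\<^bsub>Z2\<^esub> a) n) mod 2 ^ n = \<zero>\<^bsub>Z2\<^esub> n"
      using a(1) by (simp add: Z2.r_neg flip: Z2_add_apply)
    then have "(\<ominus>\<^bsub>Z2\<^esub> a) n = 0"
      using a(2) Z2_range[OF neg, of n] by (simp add: Z2_def)
    with neg show "inv\<^bsub>add_monoid Z2\<^esub> a \<in> two_pow_Z2 n"
      by (simp add: two_pow_Z2_eq a_inv_def)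
  qed (auto simp: two_pow_Z2_eq Z2_add_apply)
  then show ?thesis
    by (simp add: comm_group.normal_iff_subgroup[OF Z2.a_comm_group])
qed

section \<open>Cosets modulo \<open>2^n\<close> and the residues of their products, twists and
  inverses\<close>

text \<open>Cosets are the fibres of coordinate \<open>n\<close>, because a difference whose
  coordinate \<open>n\<close> is divisible by \<open>2^n\<close> has that coordinate equal to 0, by
  the range of coordinates.\<close>

lemma Z2_coset_eq:
  assumes "a \<in> carrier Z2"
  shows "two_pow_Z2 n #>\<^bsub>add_monoid Z2\<^esub> a = {z \<in> carrier Z2. z n = a n}"
proof (intro equalityI subsetI)
  fix z assume "z \<in> two_pow_Z2 n #>\<^bsub>add_monoid Z2\<^esub> a"
  then show "z \<in> {z \<in> carrier Z2. z n = a n}"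
    using assms Z2_range[OF assms, of n] by (auto simp: r_coset_def two_pow_Z2_eq Z2_add_apply)
next
  fix z assume "z \<in> {z \<in> carrier Z2. z n = a n}"
  then have z: "z \<in> carrier Z2" "z n = a n" by auto
  define h where "h = z \<ominus>\<^bsub>Z2\<^esub> a"
  have h: "h \<in> carrier Z2" "h \<oplus>\<^bsub>Z2\<^esub> a = z"
    using z assms by (auto simp: h_def a_minus_def Z2.a_assoc Z2.l_neg)
  have "(h n + a n) mod 2 ^ n = a n mod 2 ^ n"
    using h(2) z(2) by (metis Z2_add_apply Z2_mod_le z(1) order_refl)
  then have "2 ^ n dvd h n" by (metis add_diff_cancel_right' mod_eq_dvd_iff)
  then have "h n = 0"
    using Z2_range[OF h(1), of n] by (metis order_le_less zdvd_not_zless)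
  then show "z \<in> two_pow_Z2 n #>\<^bsub>add_monoid Z2\<^esub> a"
    using h by (auto simp: r_coset_def two_pow_Z2_eq)
qed

lemma Z2_mod_carrier: "carrier (Z2_mod_two_pow n) = (\<lambda>a. two_pow_Z2 n #>\<^bsub>add_monoid Z2\<^esub> a) ` carrier Z2"
  by (auto simp: Z2_mod_two_pow_def FactGroup_def RCOSETS_def)

lemma Z2_mod_mult: "C \<otimes>\<^bsub>Z2_mod_two_pow n\<^esub> D = C <#>\<^bsub>add_monoid Z2\<^esub> D"
  by (simp add: Z2_mod_two_pow_def)

lemma group_Z2_mod: "group (Z2_mod_two_pow n)"
  unfolding Z2_mod_two_pow_def by (rule normal.factorgroup_is_group[OF two_pow_Z2_normal])

lemma residue_coset:
  "a \<in> carrier Z2 \<Longrightarrow> residue n (two_pow_Z2 n #>\<^bsub>add_monoid Z2\<^esub> a) (a n)"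
  by (auto simp: residue_def Z2_coset_eq)

lemma residue_ex:
  assumes "C \<in> carrier (Z2_mod_two_pow n)"
  obtains r where "residue n C r"
  using assms residue_coset by (auto simp: Z2_mod_carrier)

lemma residue_set_mult:
  assumes "residue n C r" "residue n D s"
  shows "residue n (C <#>\<^bsub>add_monoid Z2\<^esub> D) ((r + s) mod 2 ^ n)"
proof -
  have C: "C \<subseteq> carrier Z2" "\<And>z. z \<in> C \<Longrightarrow> z n = r" "C \<noteq> {}"
    and D: "D \<subseteq> carrier Z2" "\<And>z. z \<in> D \<Longrightarrow> z n = s" "D \<noteq> {}"
    using assms by (auto simp: residue_def)
  then obtain c d where "c \<in> C" "d \<in> D" by auto
  then have "c \<oplus>\<^bsub>Z2\<^esub> d \<in> C <#>\<^bsub>add_monoid Z2\<^esub> D" by (auto simp: set_mult_def)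
  moreover have "C <#>\<^bsub>add_monoid Z2\<^esub> D \<subseteq> carrier Z2"
    using C(1) D(1) by (auto simp: set_mult_def)
  moreover have "z n = (r + s) mod 2 ^ n" if "z \<in> C <#>\<^bsub>add_monoid Z2\<^esub> D" for z
    using that C(2) D(2) by (auto simp: set_mult_def Z2_add_apply)
  ultimately show ?thesis unfolding residue_def by blast
qed

lemma residue_twist:
  assumes "residue n C r" "\<theta> g \<in> carrier Z2"
  shows "residue n (twist_quotient_action \<theta> g C) ((\<theta> g n * r) mod 2 ^ n)"
  using assms by (auto simp: residue_def twist_quotient_action_def twist_action_def Z2_mult_apply)

lemma residue_mono:
  assumes "residue n C r" "m \<le> n"
  shows "residue m C (r mod 2 ^ m)"
proof -
  have C: "C \<subseteq> carrier Z2" "\<And>z. z \<in> C \<Longrightarrow> z n = r" "C \<noteq> {}"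
    using assms(1) by (auto simp: residue_def)
  have "z m = r mod 2 ^ m" if "z \<in> C" for z
    using Z2_mod_le[of z m n] C that assms(2) by auto
  then show ?thesis using C by (auto simp: residue_def)
qed

lemma residue_two_pow_Z2: "residue n (two_pow_Z2 n) 0"
  using Z2.zero_closed by (force simp: residue_def two_pow_Z2_eq Z2_def)

lemma residue_reduce:
  assumes "residue n C r" "n \<ge> 1"
  shows "residue 1 (reduce_mod_two C) (r mod 2)"
  using residue_set_mult[OF residue_two_pow_Z2 residue_mono[OF assms]]
  by (simp add: reduce_mod_two_def)

text \<open>The product of \<open>C\<close> with its inverse is the neutral coset
  \<open>two_pow_Z2 n\<close>, of residue 0. This fixes the residue of the inverse modulo
  \<open>2^n\<close>, and its range fixes it exactly.\<close>

lemma residue_inv: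
  assumes C: "C \<in> carrier (Z2_mod_two_pow n)" "residue n C r"
  shows "residue n (inv\<^bsub>Z2_mod_two_pow n\<^esub> C) ((- r) mod 2 ^ n)"
proof -
  interpret Q: group "Z2_mod_two_pow n" by (rule group_Z2_mod)
  obtain s where s: "residue n (inv\<^bsub>Z2_mod_two_pow n\<^esub> C) s"
    using residue_ex Q.inv_closed C(1) by blast
  have "C \<otimes>\<^bsub>Z2_mod_two_pow n\<^esub> inv\<^bsub>Z2_mod_two_pow n\<^esub> C = two_pow_Z2 n"
    using Q.r_inv[OF C(1)] by (simp add: Z2_mod_two_pow_def)
  then have "(r + s) mod 2 ^ n = 0"
    using residue_set_mult[OF C(2) s] residue_two_pow_Z2 by (metis Z2_mod_mult residue_unique)
  then have "s mod 2 ^ n = (- r) mod 2 ^ n"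
    unfolding mod_eq_dvd_iff by (simp add: dvd_eq_mod_eq_0 add.commute)
  moreover have "0 \<le> s \<and> s < 2 ^ n"
    using s Z2_range[of _ n] unfolding residue_def by (metis ex_in_conv subsetD)
  ultimately show ?thesis using s by simp
qed

text \<open>The value of a coboundary at \<open>g\<close> is the class of (\<theta>(g) - 1)m for
  some m, and \<theta>(g) - 1 is even. Changing a cocycle by a coboundary therefore leaves its
  parity unchanged.\<close>

lemma residue_coboundary:
  assumes "b \<in> B1 G (Z2_mod_two_pow n) (twist_quotient_action \<theta>)" "g \<in> carrier G"
    and "\<theta> g \<in> carrier Z2" "odd (\<theta> g n)" "n \<ge> 1"
  obtains r where "residue n (b g) r" "even r"
proof -
  obtain M where M: "M \<in> carrier (Z2_mod_two_pow n)"
    and b: "b g = twist_quotient_action \<theta> g M <#>\<^bsub>add_monoid Z2\<^esub> inv\<^bsub>Z2_mod_two_pow n\<^esub> M"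
    using assms(1,2) by (auto simp: B1_def Z2_mod_mult)
  obtain r where r: "residue n M r" using residue_ex[OF M] .
  have "residue n (b g) (((\<theta> g n * r) mod 2 ^ n + (- r) mod 2 ^ n) mod 2 ^ n)"
    unfolding b
    by (intro residue_set_mult residue_twist residue_inv M r assms(3))
  moreover have "even (((\<theta> g n * r) mod 2 ^ n + (- r) mod 2 ^ n) mod 2 ^ n)"
    using assms(4,5) by (simp add: mod_simps dvd_mod_iff)
  ultimately show ?thesis using that by blast
qed

text \<open>A unit times its inverse is 1 in coordinate 1, and every later coordinate reduces to
  coordinate 1. Coordinate 0 is always 0, whence the bound on \<open>n\<close>.\<close>

lemma unit_Z2_odd:
  assumes "u \<in> Units Z2" "n \<ge> 1"
  shows "odd (u n)"
proof -
  obtain v where "v \<in> carrier Z2" "u \<otimes>\<^bsub>Z2\<^esub> v = \<one>\<^bsub>Z2\<^esub>" using assms(1) by (auto simp: Units_def)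
  then have "(u 1 * v 1) mod 2 = 1"
    using Z2_mult_apply[of u v 1] by (simp add: Z2_def)
  then have "odd (u 1)" by (metis even_mult_iff odd_iff_mod_2_eq_one)
  moreover have "u n mod 2 = u 1" using Z2_mod_le[of u 1 n] assms Z2.Units_closed by simp
  ultimately show ?thesis by presburger
qed

section \<open>Integers in \<open>Z2\<close> and the trivial action modulo 2\<close>

definition Z2_of_int :: "int \<Rightarrow> nat \<Rightarrow> int" where
  "Z2_of_int k = (\<lambda>n. k mod 2 ^ n)"

lemma Z2_of_int_closed [simp]: "Z2_of_int k \<in> carrier Z2"
proof -
  have "k mod 2 ^ Suc n mod 2 ^ n = k mod 2 ^ n" for n
    by (metis mod_mod_cancel le_imp_power_dvd lessI less_imp_le_nat)
  then show ?thesis by (simp add: Z2_def Z2_of_int_def)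
qed

definition parity_class :: "int \<Rightarrow> (nat \<Rightarrow> int) set" where
  "parity_class k = two_pow_Z2 1 #>\<^bsub>add_monoid Z2\<^esub> Z2_of_int k"

lemma parity_class_eq: "parity_class k = {z \<in> carrier Z2. z 1 = k mod 2}"
  unfolding parity_class_def Z2_coset_eq[OF Z2_of_int_closed] by (simp add: Z2_of_int_def)

lemma parity_class_closed: "parity_class k \<in> carrier (Z2_mod_two_pow 1)"
  by (simp add: parity_class_def Z2_mod_carrier)

lemma residue_parity_class: "residue 1 (parity_class k) (k mod 2)"
  using residue_coset[OF Z2_of_int_closed[of k], of 1]
  unfolding parity_class_def by (simp add: Z2_of_int_def[of k])

lemma parity_class_mult:
  "parity_class k \<otimes>\<^bsub>Z2_mod_two_pow 1\<^esub> parity_class l = parity_class (k + l)"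
proof -
  have "Z2_of_int k \<oplus>\<^bsub>Z2\<^esub> Z2_of_int l = Z2_of_int (k + l)"
    by (auto simp: Z2_add_apply Z2_of_int_def mod_simps)
  then show ?thesis
    using normal.rcos_sum[OF two_pow_Z2_normal[of 1], of "Z2_of_int k" "Z2_of_int l"]
    by (simp add: parity_class_def Z2_mod_mult)
qed

text \<open>Units are 1 modulo 2, so the action on the coefficients modulo 2 is trivial and cocycles
  there are just homomorphisms. Equality of sets, beyond inclusion, comes from multiplying by the
  inverse unit.\<close>

lemma twist_parity_class:
  assumes "\<theta> g \<in> Units Z2"
  shows "twist_quotient_action \<theta> g (parity_class k) = parity_class k"
proof -
  have sub: "(\<otimes>\<^bsub>Z2\<^esub>) u ` parity_class k \<subseteq> parity_class k" if "u \<in> Units Z2" for u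
  proof -
    have "u 1 = 1"
      using unit_Z2_odd[OF that, of 1] Z2_range[OF Z2.Units_closed[OF that], of 1]
      by (simp add: odd_iff_mod_2_eq_one)
    then show ?thesis
      using that by (auto simp: parity_class_eq Z2_mult_apply)
  qed
  have "z \<in> (\<otimes>\<^bsub>Z2\<^esub>) (\<theta> g) ` parity_class k" if "z \<in> parity_class k" for z
  proof (rule image_eqI)
    show "inv\<^bsub>Z2\<^esub> \<theta> g \<otimes>\<^bsub>Z2\<^esub> z \<in> parity_class k"
      using sub[of "inv\<^bsub>Z2\<^esub> \<theta> g"] assms that by auto
    show "z = \<theta> g \<otimes>\<^bsub>Z2\<^esub> (inv\<^bsub>Z2\<^esub> \<theta> g \<otimes>\<^bsub>Z2\<^esub> z)"
      using assms that by (simp add: parity_class_eq Z2.Units_r_inv flip: Z2.m_assoc[OF Z2.Units_closed])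
  qed
  then show ?thesis
    using sub[OF assms] by (auto simp: twist_quotient_action_def twist_action_def[abs_def])
qed

section \<open>Lifting homomorphisms to cocycles modulo \<open>2^n\<close>\<close>

text \<open>Extracts from the cohomological condition a statement about integer-valued functions.
  The homomorphism \<kappa> is a cocycle modulo 2, surjectivity lifts its class, and the
  coboundaries by which the reduced lift may differ from \<kappa> have even residues, so the lift
  reduces to \<kappa> itself.\<close>

lemma one_cyclotomic_lift:
  assumes G: "topological_group G T" and \<theta>: "two_orientation G T \<theta>" and cyc: "one_cyclotomic G T \<theta>"
    and n: "n \<ge> 1"
    and \<kappa>: "continuous_map T (discrete_topology {0..<2::int}) \<kappa>"
    and \<kappa>_mult: "\<And>g h. g \<in> carrier G \<Longrightarrow> h \<in> carrier G \<Longrightarrow> \<kappa> (g \<otimes>\<^bsub>G\<^esub> h) = (\<kappa> g + \<kappa> h) mod 2"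
  obtains \<gamma> where
    "\<And>g h. g \<in> carrier G \<Longrightarrow> h \<in> carrier G \<Longrightarrow>
       \<gamma> (g \<otimes>\<^bsub>G\<^esub> h) = (\<gamma> g + \<theta> g n * \<gamma> h) mod 2 ^ n"
    "\<And>g. g \<in> carrier G \<Longrightarrow> \<gamma> g mod 2 = \<kappa> g"
proof -
  interpret topological_group G T by (rule G)
  let ?act = "twist_quotient_action \<theta>"
  let ?Z = "\<lambda>n. Z1 G T (Z2_mod_two_pow n) ?act"
  let ?B = "\<lambda>n. B1 G (Z2_mod_two_pow n) ?act"
  have \<theta>_unit: "\<theta> g \<in> Units Z2" if "g \<in> carrier G" for g
    using \<theta> that by (auto simp: two_orientation_def hom_def units_of_def)
  then have \<theta>_closed: "\<theta> g \<in> carrier Z2" if "g \<in> carrier G" for g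
    using that by blast
  have \<kappa>_range: "0 \<le> \<kappa> g" "\<kappa> g < 2" if "g \<in> carrier G" for g
    using continuous_map_funspace[OF \<kappa>] that by (auto simp: topspace_eq)
  have surj: "H1_map G T (Z2_mod_two_pow 1) ?act reduce_mod_two
         ` carrier (H1 G T (Z2_mod_two_pow n) ?act) = carrier (H1 G T (Z2_mod_two_pow 1) ?act)"
  \<comment> \<open>The open subgroup is \<open>U = carrier G\<close>; restricting the group and the
    topology to it changes nothing.\<close>
  proof -
    have "openin T (carrier G)" by (metis openin_topspace topspace_eq)
    moreover have "subtopology T (carrier G) = T" by (metis subtopology_topspace topspace_eq)
    ultimately show ?thesis
      using cyc n subgroup_self unfolding one_cyclotomic_def by force
  qed
  define c where "c = (\<lambda>g \<in> carrier G. parity_class (\<kappa> g))"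
  have "continuous_map T (discrete_topology (carrier (Z2_mod_two_pow 1))) (parity_class \<circ> \<kappa>)"
    using \<kappa> by (rule continuous_map_compose) (auto simp: parity_class_closed[simplified])
  then have "continuous_map T (discrete_topology (carrier (Z2_mod_two_pow 1))) c"
    by (rule continuous_map_eq) (auto simp: c_def topspace_eq)
  moreover have "c (g \<otimes>\<^bsub>G\<^esub> h) = c g \<otimes>\<^bsub>Z2_mod_two_pow 1\<^esub> ?act g (c h)"
    if "g \<in> carrier G" "h \<in> carrier G" for g h
    \<comment> \<open>\<open>\<kappa>_mult\<close> gives the sum reduced modulo 2,
      \<open>parity_class_mult\<close> the unreduced one; both name the same coset.\<close>
    using that parity_class_eq[of "(\<kappa> g + \<kappa> h) mod 2"] parity_class_eq[of "\<kappa> g + \<kappa> h"]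
    by (simp add: c_def \<kappa>_mult twist_parity_class \<theta>_unit parity_class_mult[simplified])
  ultimately have c: "c \<in> carrier (?Z 1)"
    by (simp add: Z1_def) (auto simp: c_def parity_class_closed[simplified])
  then have "?B 1 #>\<^bsub>?Z 1\<^esub> c \<in> carrier (H1 G T (Z2_mod_two_pow 1) ?act)"
    by (auto simp: H1_def FactGroup_def RCOSETS_def)
  then obtain D where D: "D \<in> carrier (H1 G T (Z2_mod_two_pow n) ?act)"
    and D_eq: "H1_map G T (Z2_mod_two_pow 1) ?act reduce_mod_two D = ?B 1 #>\<^bsub>?Z 1\<^esub> c"
    unfolding surj[symmetric] by blast
  obtain C where C: "C \<in> carrier (?Z n)" and D_coset: "D = ?B n #>\<^bsub>?Z n\<^esub> C"
    using D by (auto simp: H1_def FactGroup_def RCOSETS_def)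
  \<comment> \<open>Any coboundary \<open>b0\<close> will do: it picks an element of the class of
    \<open>c\<close>, so that the equality of classes becomes an equation between cocycles.\<close>
  have "two_pow_Z2 1 #>\<^bsub>add_monoid Z2\<^esub> Z2_of_int 0 \<in> carrier (Z2_mod_two_pow 1)"
    by (simp add: Z2_mod_carrier)
  then obtain b0 where "b0 \<in> ?B 1" unfolding B1_def by blast
  then have "b0 \<otimes>\<^bsub>?Z 1\<^esub> c \<in> H1_map G T (Z2_mod_two_pow 1) ?act reduce_mod_two D"
    unfolding D_eq by (auto simp: r_coset_def)
  then obtain b b' where b: "b \<in> ?B 1" and b': "b' \<in> ?B n"
    and eq: "b0 \<otimes>\<^bsub>?Z 1\<^esub> c = b \<otimes>\<^bsub>?Z 1\<^esub> compose (carrier G) reduce_mod_two (b' \<otimes>\<^bsub>?Z n\<^esub> C)"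
    unfolding H1_map_def D_coset by (auto simp: set_mult_def r_coset_def)
  have C_closed: "C g \<in> carrier (Z2_mod_two_pow n)" if "g \<in> carrier G" for g
    using C that by (auto simp: Z1_def)
  \<comment> \<open>A representative in integers of the lifted cocycle; the choice is forced on
    \<open>carrier G\<close>, where residues exist and are unique.\<close>
  define \<gamma> where "\<gamma> g = (SOME r. residue n (C g) r)" for g
  have \<gamma>: "residue n (C g) (\<gamma> g)" if "g \<in> carrier G" for g
    unfolding \<gamma>_def using residue_ex[OF C_closed[OF that]] by (metis someI)
  show ?thesis
  proof (rule that)
    fix g h assume gh: "g \<in> carrier G" "h \<in> carrier G"
    then have "C (g \<otimes>\<^bsub>G\<^esub> h) = C g <#>\<^bsub>add_monoid Z2\<^esub> ?act g (C h)"
      using C by (simp add: Z1_def Z2_mod_mult)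
    then have "residue n (C (g \<otimes>\<^bsub>G\<^esub> h)) ((\<gamma> g + (\<theta> g n * \<gamma> h) mod 2 ^ n) mod 2 ^ n)"
      by (simp only:) (intro residue_set_mult residue_twist \<gamma> gh \<theta>_closed)
    then show "\<gamma> (g \<otimes>\<^bsub>G\<^esub> h) = (\<gamma> g + \<theta> g n * \<gamma> h) mod 2 ^ n"
      using \<gamma>[of "g \<otimes>\<^bsub>G\<^esub> h"] gh residue_unique by (force simp: mod_simps)
  next
    fix g assume g: "g \<in> carrier G"
    note odd = unit_Z2_odd[OF \<theta>_unit[OF g]]
    obtain r0 where r0: "residue 1 (b0 g) r0" "even r0"
      using residue_coboundary[OF \<open>b0 \<in> ?B 1\<close> g \<theta>_closed[OF g]] odd by blast
    obtain r where r: "residue 1 (b g) r" "even r"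
      using residue_coboundary[OF b g \<theta>_closed[OF g]] odd by blast
    obtain r' where r': "residue n (b' g) r'" "even r'"
      using residue_coboundary[OF b' g \<theta>_closed[OF g]] odd n by blast
    \<comment> \<open>The equation of cocycles is evaluated at \<open>g\<close>. Taking residues
      modulo 2 removes \<open>b0\<close>, \<open>b\<close> and \<open>b'\<close>, all even, and
      leaves \<kappa> and \<gamma> with equal parity.\<close>
    have "b0 g <#>\<^bsub>add_monoid Z2\<^esub> parity_class (\<kappa> g)
        = b g <#>\<^bsub>add_monoid Z2\<^esub> reduce_mod_two (b' g <#>\<^bsub>add_monoid Z2\<^esub> C g)"
      using fun_cong[OF eq, of g] g by (simp add: Z1_def compose_def c_def Z2_mod_mult)
    moreover have "residue 1 (b0 g <#>\<^bsub>add_monoid Z2\<^esub> parity_class (\<kappa> g)) ((r0 + \<kappa> g mod 2) mod 2 ^ 1)"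
      by (intro residue_set_mult r0 residue_parity_class)
    moreover have "residue 1 (b g <#>\<^bsub>add_monoid Z2\<^esub> reduce_mod_two (b' g <#>\<^bsub>add_monoid Z2\<^esub> C g))
        ((r + (r' + \<gamma> g) mod 2 ^ n mod 2) mod 2 ^ 1)"
      by (intro residue_set_mult r residue_reduce[OF _ n] r' \<gamma> g)
    ultimately have "(r0 + \<kappa> g mod 2) mod 2 = (r + (r' + \<gamma> g) mod 2 ^ n mod 2) mod 2"
      using residue_unique by force
    moreover have "(r' + \<gamma> g) mod 2 ^ n mod 2 = (r' + \<gamma> g) mod 2"
      using n by (simp add: mod_mod_cancel)
    ultimately have "(r0 + \<kappa> g mod 2) mod 2 = (r + (r' + \<gamma> g) mod 2) mod 2"
      by (simp only:)
    then have "even (r0 + \<kappa> g mod 2) = even (r + (r' + \<gamma> g) mod 2)"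
      by (metis even_iff_mod_2_eq_zero)
    then have "even (\<kappa> g) = even (\<gamma> g)"
      using r0(2) r(2) r'(2) by simp
    then show "\<gamma> g mod 2 = \<kappa> g"
      using \<kappa>_range[OF g] by presburger
  qed
qed

section \<open>The two obstructions modulo 4\<close>

theorem proposition6p5:
  fixes G :: "('a, 'm) monoid_scheme" and T :: "'a topology"
  assumes "pro_2_group G T"
    and "topological_group_isomorphic G T
           (integer_mod_group 2 \<times>\<times> add_monoid Z2)
           (prod_topology (discrete_topology (carrier (integer_mod_group 2))) Z2_topology)"
  shows "\<not> (\<exists>\<theta>. two_orientation G T \<theta> \<and> one_cyclotomic G T \<theta>)"
proof
  let ?H = "integer_mod_group 2 \<times>\<times> add_monoid Z2"
  assume "\<exists>\<theta>. two_orientation G T \<theta> \<and> one_cyclotomic G T \<theta>"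
  then obtain \<theta> where \<theta>: "two_orientation G T \<theta>" "one_cyclotomic G T \<theta>" by blast
  have G: "topological_group G T"
    using assms(1) by (simp add: pro_2_group_def profinite_group_def)
  interpret topological_group G T by (rule G)
  obtain f where f: "f \<in> iso G ?H"
    and f_homeo: "homeomorphic_map T
        (prod_topology (discrete_topology (carrier (integer_mod_group 2))) Z2_topology) f"
    using assms(2) by (auto simp: topological_group_isomorphic_def)
  have C2: "carrier (integer_mod_group 2) = {0..<2}"
    by (simp add: carrier_integer_mod_group)
  have f_cont: "continuous_map T (prod_topology (discrete_topology {0..<2}) Z2_topology) f"
    using f_homeo homeomorphic_imp_continuous_map by (simp add: C2)
  have f_bij: "bij_betw f (carrier G) ({0..<2} \<times> carrier Z2)"
    using f by (simp add: iso_def C2)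
  have f_mult: "f (g \<otimes>\<^bsub>G\<^esub> h) = ((fst (f g) + fst (f h)) mod 2, snd (f g) \<oplus>\<^bsub>Z2\<^esub> snd (f h))"
    if "g \<in> carrier G" "h \<in> carrier G" for g h
    using f that by (auto simp: iso_def hom_def mult_DirProd' integer_mod_group_def)
  \<comment> \<open>The generators of the two factors: \<open>x\<close> is the involution,
    \<open>y\<close> the topological generator of the 2-adic factor.\<close>
  have "(1, Z2_of_int 0) \<in> f ` carrier G" "(0, Z2_of_int 1) \<in> f ` carrier G"
    using f_bij by (auto simp: bij_betw_def)
  then obtain x y where x: "x \<in> carrier G" "f x = (1, Z2_of_int 0)"
    and y: "y \<in> carrier G" "f y = (0, Z2_of_int 1)" by (metis imageE)
  have f_inj: "g = h" if "f g = f h" "g \<in> carrier G" "h \<in> carrier G" for g h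
    using f_bij that by (meson bij_betw_def inj_onD)
  have xy: "x \<otimes>\<^bsub>G\<^esub> y = y \<otimes>\<^bsub>G\<^esub> x"
    by (rule f_inj) (use x y in \<open>auto simp: f_mult Z2.a_comm\<close>)
  have xx: "x \<otimes>\<^bsub>G\<^esub> x = \<one>\<^bsub>G\<^esub>"
  proof -
    \<comment> \<open>Comparing the cube of \<open>x\<close> with \<open>x\<close> avoids computing
      the image of the neutral element under \<open>f\<close>.\<close>
    have "x \<otimes>\<^bsub>G\<^esub> x \<otimes>\<^bsub>G\<^esub> x = x"
      by (rule f_inj) (use x in \<open>auto simp: f_mult Z2_add_apply Z2_of_int_def\<close>)
    then show ?thesis using x(1) by (metis m_closed r_cancel_one)
  qed
  \<comment> \<open>Coordinate 2 is the residue modulo 4, so the value 3 stands for -1.\<close>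
  have \<theta>_cases: "\<theta> g 2 = 1 \<or> \<theta> g 2 = 3" if "g \<in> carrier G" for g
  proof -
    have "\<theta> g \<in> Units Z2"
      using \<theta>(1) that by (auto simp: two_orientation_def hom_def units_of_def)
    then have "odd (\<theta> g 2)" "0 \<le> \<theta> g 2 \<and> \<theta> g 2 < 2 ^ 2"
      using unit_Z2_odd Z2_range Z2.Units_closed by (simp, blast)
    then show ?thesis by (simp, presburger)
  qed
  from \<theta>_cases[OF x(1)] show False
  proof
    assume \<theta>x: "\<theta> x 2 = 1"
    \<comment> \<open>The homomorphism to be lifted is the projection to the factor of order 2,
      which is nontrivial on \<open>x\<close>.\<close>
    have fst_cont: "continuous_map T (discrete_topology {0..<2}) (\<lambda>g. fst (f g))"
      using continuous_map_fst_of[OF f_cont] by (simp add: o_def)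
    obtain \<gamma> where
      cocycle: "\<And>g h. g \<in> carrier G \<Longrightarrow> h \<in> carrier G \<Longrightarrow>
        \<gamma> (g \<otimes>\<^bsub>G\<^esub> h) = (\<gamma> g + \<theta> g 2 * \<gamma> h) mod 2 ^ 2"
      and parity: "\<And>g. g \<in> carrier G \<Longrightarrow> \<gamma> g mod 2 = fst (f g)"
      by (rule one_cyclotomic_lift[where n = 2, OF G \<theta> _ fst_cont]) (auto simp: f_mult)
    have "\<gamma> x mod 2 = 1" using parity[OF x(1)] x(2) by simp
    \<comment> \<open>As \<gamma>(x) is odd, its double is 2 modulo 4, whereas the cocycle rule for
      the pair of \<open>x\<close> and the neutral element makes \<gamma>(1) vanish modulo
      4.\<close>
    moreover have "\<gamma> \<one>\<^bsub>G\<^esub> = (\<gamma> x + \<gamma> x) mod 4" using cocycle[OF x(1) x(1)] xx \<theta>x by simp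
    moreover have "\<gamma> x = (\<gamma> x + \<gamma> \<one>\<^bsub>G\<^esub>) mod 4" using cocycle[of x "\<one>\<^bsub>G\<^esub>"] x(1) \<theta>x by simp
    ultimately show False by presburger
  next
    assume \<theta>x: "\<theta> x 2 = 3"
    \<comment> \<open>The homomorphism to be lifted is now the 2-adic component reduced modulo 2,
      that is, its coordinate 1. It is trivial on \<open>x\<close> and nontrivial on
      \<open>y\<close>.\<close>
    have "continuous_map T (product_topology (\<lambda>n. discrete_topology {0..<2 ^ n}) UNIV)
        (\<lambda>g. snd (f g))"
      using continuous_map_snd_of[OF f_cont]
      by (simp add: o_def Z2_topology_def continuous_map_in_subtopology)
    then have "\<forall>n. continuous_map T (discrete_topology {0..<2 ^ n}) (\<lambda>g. snd (f g) n)"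
      unfolding continuous_map_componentwise_UNIV .
    from spec[OF this, of 1]
    have snd_cont: "continuous_map T (discrete_topology {0..<2}) (\<lambda>g. snd (f g) 1)" by simp
    obtain \<gamma> where
      cocycle: "\<And>g h. g \<in> carrier G \<Longrightarrow> h \<in> carrier G \<Longrightarrow>
        \<gamma> (g \<otimes>\<^bsub>G\<^esub> h) = (\<gamma> g + \<theta> g 2 * \<gamma> h) mod 2 ^ 2"
      and parity: "\<And>g. g \<in> carrier G \<Longrightarrow> \<gamma> g mod 2 = snd (f g) 1"
      by (rule one_cyclotomic_lift[where n = 2, OF G \<theta> _ snd_cont]) (auto simp: f_mult Z2_add_apply)
    have "even (\<gamma> x)" "odd (\<gamma> y)"
      using parity[OF x(1)] parity[OF y(1)] x(2) y(2)
      by (simp_all add: Z2_of_int_def even_iff_mod_2_eq_zero odd_iff_mod_2_eq_one)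
    then obtain a b where ab: "\<gamma> x = 2 * a" "\<gamma> y = 2 * b + 1" by (meson evenE oddE)
    have "(\<gamma> x + 3 * \<gamma> y) mod 4 = (\<gamma> y + \<theta> y 2 * \<gamma> x) mod 4"
      using cocycle[OF x(1) y(1)] cocycle[OF y(1) x(1)] xy \<theta>x by simp
    \<comment> \<open>The left side equals 2a(1 - \<theta>(y)) + 4b + 2. Since \<theta>(y) is odd,
      this is 2 modulo 4, so it cannot be 4k.\<close>
    then obtain k where k: "2 * a + 3 * (2 * b + 1) - (2 * b + 1 + \<theta> y 2 * (2 * a)) = 4 * k"
      unfolding ab mod_eq_dvd_iff by (elim dvdE)
    from \<theta>_cases[OF y(1)] show False
    proof
      assume "\<theta> y 2 = 1"
      with k show False by simp presburger
    next
      assume "\<theta> y 2 = 3"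
      with k show False by simp presburger
    qed
  qed
qed

end
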